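(* Let $D$ be the Dynkin diagram of the rank 3 hyperbolic Kac-Moody algebra $AC_2^{(1)}$: vertices $1,2,3$, a single edge $1-2$, and double edges joining $3$ to $1$ and $3$ to $2$, both with arrow pointing toward $3$ (so $\alpha_1,\alpha_2$ are long and $\alpha_3$ is short). The equivalence classes of nonempty paintings of $D$ are given by the representatives (a) $(1)$; (b) $(3)$; (c) $(1,2)$. That is, these three paintings are pairwise inequivalent and every nonempty painting is equivalent to one of them.
   Context: A painting of a Dynkin diagram is a choice of a subset of its vertices, called painted (a Vogan diagram with trivial diagram involution). The painting whose painted vertices are exactly $i_1,\dots,i_k$ is denoted $(i_1,\dots,i_k)$. For a painted vertex $i$, the operation $F\langle i\rangle$ (reflection in the noncompact simple root $i$) changes the painting as follows: (i) the color of $i$ and of all vertices not adjacent to $i$ is unchanged; (ii) if $j$ is joined to $i$ by a double edge and $j$ is the long root, the color of $j$ is unchanged; (iii) the colors of all other vertices adjacent to $i$ are reversed. Equivalence of paintings is the equivalence relation generated by all operations $F\langle i\rangle$ ($i$ painted) and by automorphisms of the Dynkin diagram. *)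

theory Defs
  imports Main
begin

text \<open>
  A Dynkin diagram: the number of edges is attached to the unordered pair of its end points
  (0 if they are not joined), and \<open>(i, j) \<in> arrows D\<close> means that the edge between
  \<open>i\<close> and \<open>j\<close> carries an arrow pointing toward \<open>j\<close>, i.e. the root
  \<open>i\<close> is longer than the root \<open>j\<close>.
\<close>

record 'v dynkin_diagram =
  verts :: "'v set"
  edge_mult :: "'v set \<Rightarrow> nat"
  arrows :: "('v \<times> 'v) set"

definition adjacent :: "'v dynkin_diagram \<Rightarrow> 'v \<Rightarrow> 'v \<Rightarrow> bool" where
  "adjacent D i j \<longleftrightarrow>
     i \<in> verts D \<and> j \<in> verts D \<and> i \<noteq> j \<and> edge_mult D {i, j} > 0"

definition diagram_automorphism :: "'v dynkin_diagram \<Rightarrow> ('v \<Rightarrow> 'v) \<Rightarrow> bool" where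
  "diagram_automorphism D g \<longleftrightarrow>
     bij_betw g (verts D) (verts D) \<and>
     (\<forall>i\<in>verts D. \<forall>j\<in>verts D.
        edge_mult D {g i, g j} = edge_mult D {i, j} \<and>
        ((g i, g j) \<in> arrows D \<longleftrightarrow> (i, j) \<in> arrows D))"

text \<open>A painting is identified with the set of its painted vertices.\<close>

definition painting :: "'v dynkin_diagram \<Rightarrow> 'v set \<Rightarrow> bool" where
  "painting D P \<longleftrightarrow> P \<subseteq> verts D"

definition long_double_neighbour :: "'v dynkin_diagram \<Rightarrow> 'v \<Rightarrow> 'v \<Rightarrow> bool" where
  "long_double_neighbour D i j \<longleftrightarrow>
     adjacent D i j \<and> edge_mult D {i, j} = 2 \<and> (j, i) \<in> arrows D"

definition reflect_painting :: "'v dynkin_diagram \<Rightarrow> 'v \<Rightarrow> 'v set \<Rightarrow> 'v set" where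
  "reflect_painting D i P =
     {j \<in> verts D.
        if adjacent D i j \<and> \<not> long_double_neighbour D i j then j \<notin> P else j \<in> P}"

definition painting_step :: "'v dynkin_diagram \<Rightarrow> 'v set \<Rightarrow> 'v set \<Rightarrow> bool" where
  "painting_step D P Q \<longleftrightarrow>
     painting D P \<and>
     ((\<exists>i\<in>P. Q = reflect_painting D i P) \<or>
      (\<exists>g. diagram_automorphism D g \<and> Q = g ` P))"

definition painting_equiv :: "'v dynkin_diagram \<Rightarrow> 'v set \<Rightarrow> 'v set \<Rightarrow> bool" where
  "painting_equiv D = equivclp (painting_step D)"

definition AC2_1 :: "nat dynkin_diagram" where
  "AC2_1 =
     \<lparr>verts = {1, 2, 3},
      edge_mult = (\<lambda>e. if e = {1, 2} then 1
                       else if e = {1, 3} \<or> e = {2, 3} then 2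
                       else 0),
      arrows = {(1, 3), (2, 3)}\<rparr>"

end

theory Submission
  imports Defs
begin

text \<open>
  The operation at 3 does nothing, since both neighbours of 3 are long; the operation at 1 or 2
  reverses exactly two colours and leaves a long vertex painted; and every automorphism fixes 3.
  Hence the parity of the number of painted vertices, together with the existence of a painted
  long vertex, is invariant, and it separates the three representatives.
\<close>

lemma painting_AC2_1_iff: "painting AC2_1 P \<longleftrightarrow> P \<subseteq> {1, 2, 3}"
  by (simp add: painting_def AC2_1_def)

text \<open>Vertex 2 is joined to 1 by a single edge, and 3 is the short end of its double edge to
  1. The exception for long neighbours thus never applies, and both colours flip.\<close>

lemma reflect_AC2_1_1:
  "reflect_painting AC2_1 1 P = {j \<in> {1, 2, 3}. if j = 1 then j \<in> P else j \<notin> P}"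
  by (auto simp: reflect_painting_def long_double_neighbour_def adjacent_def AC2_1_def
      doubleton_eq_iff)

lemma reflect_AC2_1_2:
  "reflect_painting AC2_1 2 P = {j \<in> {1, 2, 3}. if j = 2 then j \<in> P else j \<notin> P}"
  by (auto simp: reflect_painting_def long_double_neighbour_def adjacent_def AC2_1_def
      doubleton_eq_iff)

lemma reflect_AC2_1_3:
  "reflect_painting AC2_1 3 P = P \<inter> {1, 2, 3}"
  by (auto simp: reflect_painting_def long_double_neighbour_def adjacent_def AC2_1_def
      doubleton_eq_iff)

lemma automorphism_AC2_1:
  assumes "diagram_automorphism AC2_1 g"
  shows "inj_on g {1, 2, 3}" and "g 3 = 3" and "g ` {1, 2} = {1, 2}"
proof -
  have bij: "bij_betw g {1, 2, 3} {1, 2, 3}"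
    using assms by (simp add: diagram_automorphism_def AC2_1_def)
  then show inj: "inj_on g {1, 2, 3}"
    by (rule bij_betw_imp_inj_on)
  \<comment> \<open>The image of the arrow \<open>(1, 3)\<close> is again an arrow, and every arrow
    of the diagram points to 3.\<close>
  have "(g 1, g 3) \<in> arrows AC2_1"
    using assms by (simp add: diagram_automorphism_def AC2_1_def)
  then show g3: "g 3 = 3"
    by (auto simp: AC2_1_def)
  have "g ` ({1, 2, 3} - {3}) = g ` {1, 2, 3} - g ` {3}"
    by (rule inj_on_image_set_diff[OF inj]) auto
  also have "\<dots> = {1, 2, 3} - {3}"
    using bij_betw_imp_surj_on[OF bij] g3 by simp
  finally show "g ` {1, 2} = {1, 2}"
    by (simp add: insert_Diff_if)
qed

definition AC2_1_invariant :: "nat set \<Rightarrow> bool \<times> bool" where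
  "AC2_1_invariant P = (even (card P), P \<inter> {1, 2} = {})"

lemma subset_123_cases:
  assumes "P \<subseteq> {1, 2, 3 :: nat}"
  obtains "P = {}" | "P = {1}" | "P = {2}" | "P = {3}"
    | "P = {1, 2}" | "P = {1, 3}" | "P = {2, 3}" | "P = {1, 2, 3}"
proof -
  have "P \<in> Pow {1, 2, 3}"
    using assms by simp
  then show thesis
    unfolding Pow_insert Pow_empty image_Un image_insert image_empty Un_iff insert_iff empty_iff
    using that by argo
qed

text \<open>These are all the reflections at 1 and at 2 that are allowed: the four paintings
  containing 1 and the four containing 2.\<close>

lemma reflect_AC2_1_values:
  "reflect_painting AC2_1 1 {1} = {1, 2, 3}"
  "reflect_painting AC2_1 1 {1, 2} = {1, 3}"
  "reflect_painting AC2_1 1 {1, 3} = {1, 2}"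
  "reflect_painting AC2_1 1 {1, 2, 3} = {1}"
  "reflect_painting AC2_1 2 {2} = {1, 2, 3}"
  "reflect_painting AC2_1 2 {1, 2} = {2, 3}"
  "reflect_painting AC2_1 2 {2, 3} = {1, 2}"
  "reflect_painting AC2_1 2 {1, 2, 3} = {2}"
  unfolding reflect_AC2_1_1 reflect_AC2_1_2 by auto

lemma AC2_1_invariant_reflect:
  assumes P: "P \<subseteq> {1, 2, 3}" and "i \<in> P"
  shows "AC2_1_invariant (reflect_painting AC2_1 i P) = AC2_1_invariant P"
proof -
  consider "i = 1" | "i = 2" | "i = 3"
    using assms by blast
  then show ?thesis
  proof cases
    case 1
    then have "1 \<in> P"
      using assms by simp
    \<comment> \<open>Of the eight paintings, those without 1 contradict \<open>1 \<in> P\<close>;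
      the table settles the other four.\<close>
    with P 1 show ?thesis
      by (elim subset_123_cases)
        (simp_all only: reflect_AC2_1_values, simp_all add: AC2_1_invariant_def)
  next
    case 2
    then have "2 \<in> P"
      using assms by simp
    with P 2 show ?thesis
      by (elim subset_123_cases)
        (simp_all only: reflect_AC2_1_values, simp_all add: AC2_1_invariant_def)
  next
    case 3
    then show ?thesis
      using P by (simp add: reflect_AC2_1_3 Int_absorb2)
  qed
qed

lemma AC2_1_invariant_automorphism:
  assumes P: "P \<subseteq> {1, 2, 3}" and g: "diagram_automorphism AC2_1 g"
  shows "AC2_1_invariant (g ` P) = AC2_1_invariant P"
proof -
  note inj = automorphism_AC2_1(1)[OF g]
  have "card (g ` P) = card P"
    using P inj by (intro card_image) (rule inj_on_subset)
  \<comment> \<open>Since \<open>{1, 2}\<close> is its own image and \<open>g\<close> is injective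
    on the vertices, intersecting with it commutes with taking images.\<close>
  moreover have "g ` P \<inter> {1, 2} = g ` (P \<inter> {1, 2})"
    using inj_on_image_Int[OF inj P, of "{1, 2}"] automorphism_AC2_1(3)[OF g] by auto
  ultimately show ?thesis
    by (simp add: AC2_1_invariant_def)
qed

lemma AC2_1_invariant_equiv:
  assumes "painting_equiv AC2_1 P Q"
  shows "AC2_1_invariant P = AC2_1_invariant Q"
proof -
  have step: "AC2_1_invariant R = AC2_1_invariant S" if "painting_step AC2_1 R S" for R S
    using that unfolding painting_step_def painting_AC2_1_iff
    by (metis AC2_1_invariant_reflect AC2_1_invariant_automorphism)
  from assms show ?thesis
    unfolding painting_equiv_def
    by (induction rule: equivclp_induct) (auto dest: step)
qed

text \<open>The equivalence is the symmetric closure of the steps, so a reflection can be read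
  backwards, from its result to the painting it started from.\<close>

lemma painting_equiv_reflect:
  assumes "painting D P" and "i \<in> P"
  shows "painting_equiv D (reflect_painting D i P) P"
    and "painting_equiv D P (reflect_painting D i P)"
proof -
  have "painting_step D P (reflect_painting D i P)"
    using assms by (auto simp: painting_step_def)
  then show "painting_equiv D (reflect_painting D i P) P"
    and "painting_equiv D P (reflect_painting D i P)"
    unfolding painting_equiv_def by (rule converse_r_into_equivclp, rule r_into_equivclp)
qed

theorem proposition6p3:
  shows "(\<not> painting_equiv AC2_1 {1} {3}
          \<and> \<not> painting_equiv AC2_1 {1} {1, 2}
          \<and> \<not> painting_equiv AC2_1 {3} {1, 2})
       \<and> (\<forall>P. painting AC2_1 P \<and> P \<noteq> {} \<longrightarrow>
            painting_equiv AC2_1 P {1}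
            \<or> painting_equiv AC2_1 P {3}
            \<or> painting_equiv AC2_1 P {1, 2})"
proof (intro conjI allI impI)
  \<comment> \<open>The invariant is \<open>(False, False)\<close> on \<open>{1}\<close>,
    \<open>(False, True)\<close> on \<open>{3}\<close> and \<open>(True, False)\<close> on
    \<open>{1, 2}\<close>.\<close>
  show "\<not> painting_equiv AC2_1 {1} {3}" "\<not> painting_equiv AC2_1 {1} {1, 2}"
    "\<not> painting_equiv AC2_1 {3} {1, 2}"
    by (auto dest!: AC2_1_invariant_equiv simp: AC2_1_invariant_def)
next
  fix P
  assume P: "painting AC2_1 P \<and> P \<noteq> {}"
  have refl: "painting_equiv AC2_1 R R" for R
    by (simp add: painting_equiv_def)
  \<comment> \<open>The full painting links \<open>{1}\<close> and \<open>{2}\<close>: it arises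
    from the former by reflection at 1 and from the latter by reflection at 2.\<close>
  have e123: "painting_equiv AC2_1 {1, 2, 3} {1}"
    using painting_equiv_reflect(1)[of AC2_1 "{1}" 1]
    by (simp only: reflect_AC2_1_values painting_AC2_1_iff) simp
  have "painting_equiv AC2_1 {2} {1, 2, 3}"
    using painting_equiv_reflect(2)[of AC2_1 "{2}" 2]
    by (simp only: reflect_AC2_1_values painting_AC2_1_iff) simp
  then have e2: "painting_equiv AC2_1 {2} {1}"
    using e123 unfolding painting_equiv_def by (rule equivclp_trans)
  \<comment> \<open>The other two paintings with exactly two painted vertices are the reflections of
    \<open>{1, 2}\<close> at 1 and at 2.\<close>
  have e13: "painting_equiv AC2_1 {1, 3} {1, 2}"
    using painting_equiv_reflect(1)[of AC2_1 "{1, 2}" 1]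
    by (simp only: reflect_AC2_1_values painting_AC2_1_iff) simp
  have e23: "painting_equiv AC2_1 {2, 3} {1, 2}"
    using painting_equiv_reflect(1)[of AC2_1 "{1, 2}" 2]
    by (simp only: reflect_AC2_1_values painting_AC2_1_iff) simp
  from P have "P \<subseteq> {1, 2, 3}" "P \<noteq> {}"
    by (simp_all add: painting_AC2_1_iff)
  then show "painting_equiv AC2_1 P {1} \<or> painting_equiv AC2_1 P {3}
      \<or> painting_equiv AC2_1 P {1, 2}"
    by (elim subset_123_cases) (use refl e123 e2 e13 e23 in blast)+
qed

end
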